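(* Let $(T,f)$ and $(G,g)$ be merge trees with associated metric merge trees $\mathbf{T}$ and $\mathbf{G}$, let $C\in\mathcal{C}(T,G)$ be a coupling, and let $\varepsilon\ge \|C\|_\infty$. Then the map $\alpha_C^{\varepsilon}:\mathbf{T}\to\mathbf{G}$ is an $\varepsilon$-good map.
   Context: **Merge trees.** A merge tree $(T,f)$ is a finite rooted tree with vertex set $V_T$ and root $r_T$, the root having order (number of incident edges) $>1$, together with an injective function $f:V_T\to\mathbb{R}$ which is strictly increasing for the partial order on $V_T$ generated by child $<$ father (so $r_T$ is the maximum). $\mathrm{LCA}$ denotes the least common ancestor (least upper bound) of a set of vertices. The metric merge tree $\mathbf{T}$ is obtained by gluing, along common vertices, an interval $[f(x),f(x')]$ for each edge from a child $x$ to its father $x'$, and a half-line $[f(r_T),+\infty)$ at the root. It carries the shortest path metric, contains $V_T$, and $f$ and the partial order extend to it (for each $x$ the set $\{x'\ge x\}$ is a chain mapped by $f$ bijectively onto $[f(x),+\infty)$). For $k\ge 0$, $s_T^k(x)$ is the unique $x'\ge x$ with $f(x')=f(x)+k$. **$\varepsilon$-good maps.** A continuous map $\alpha:\mathbf{T}\to\mathbf{G}$ is $\varepsilon$-good if: (P1) $g(\alpha(x))=f(x)+\varepsilon$ for all $x\in\mathbf{T}$; (P2) if $\alpha(x)<\alpha(x')$ then $s_T^{2\varepsilon}(x)<s_T^{2\varepsilon}(x')$; (P3) if $y\in\mathbf{G}-\alpha(\mathbf{T})$ and $w=\min\{y'>y\mid y'\in\alpha(\mathbf{T})\}$, then $g(w)-g(y)\le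 2\varepsilon$. **Couplings.** For $C\subset V_T\times V_G$ with projections $\pi_T,\pi_G$, let $\Lambda_C^T(v)$ be the set of maximal elements of $\{v'\in\pi_T(C)\mid v'<v\}$ (possibly empty); similarly $\Lambda_C^G$. Order $C$ by $(a,b)<(c,d)$ iff $a<c$ and $b<d$. $C$ is a coupling, $C\in\mathcal{C}(T,G)$, if: (C1) $\#\max C=1$ (equivalently $\#\max\pi_T(C)=\#\max\pi_G(C)=1$); (C2) $\pi_T$ and $\pi_G$ are injective on $C$; (C3) for $(a,b),(c,d)\in C$, $a<c$ iff $b<d$; (C4) $a\in\pi_T(C)$ implies $\#\Lambda_C^T(a)\ne 1$, and the same for $G$. The unused vertices are $U_C^T=\{v\in V_T\mid \#\Lambda_C^T(v)=1\}$, the deleted ones are $D_C^T=\{v\in V_T\mid v\notin\pi_T(C),\ \#\Lambda_C^T(v)\neq 1\}$; $V_T$ is the disjoint union of $\pi_T(C),U_C^T,D_C^T$. Same for $G$. **The vertex maps.** For $x\in V_T$ let: $\varphi(x)=\min\{v\in V_T\mid v>x,\ \exists v'\le v \text{ with } v'\in\pi_T(C)\}$; $\eta(x)\in V_G$ the vertex $w$ minimizing $g(w)$ among all $(v,w)\in C$ with $v\le\varphi(x)$; $\chi(x)=\mathrm{LCA}\{w\mid (v,w)\in C,\ v\in\Lambda_C^T(x)\}\in V_G$. Define $\alpha_C:V_T-U_C^T\to\mathbf{G}$ by: $\alpha_C(x)=y$ if $(x,y)\in C$; if $x\in D_C^T$ and $\#\Lambda_C^T(x)=0$, $\alpha_C(x)$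 is the point of $\mathbf{G}$ above $\eta(x)$ at height $\max\{g(\eta(x)),\tfrac12(f(x)+f(\varphi(x)))\}$; if $x\in D_C^T$ and $\#\Lambda_C^T(x)>1$, $\alpha_C(x)=\chi(x)$. The map $\beta_C:V_G-U_C^G\to\mathbf{T}$ is defined in the same way exchanging the roles of $(T,f)$ and $(G,g)$. **Cost.** $\|C\|_\infty=\max\{\max_{x\in V_T-U_C^T}|g(\alpha_C(x))-f(x)|,\ \max_{y\in V_G-U_C^G}|f(\beta_C(y))-g(y)|\}$. **The map $\alpha_C^\varepsilon$.** Let $\varepsilon\ge\|C\|_\infty$. For $x\in V_T-U_C^T$ put $\alpha_C^\varepsilon(x)=s_G^{k}(\alpha_C(x))$ with $k=f(x)+\varepsilon-g(\alpha_C(x))\ge 0$. For every other $x\in\mathbf{T}$, let $l_C(x)$ be a maximal element of $\{v\in V_T\mid v\le x,\ v\in\pi_T(C)\cup D_C^T\}$, where if there are several maximal elements one takes the unique one belonging to $\pi_T(C)$; then $\alpha_C^\varepsilon(x)$ is the point of $\mathbf{G}$ above $\alpha_C^\varepsilon(l_C(x))$ at height $f(x)+\varepsilon$. *)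

theory Defs
  imports "HOL-Analysis.Analysis"
begin

section \<open>Merge trees\<close>

text \<open>An edge is the pair (child, father).\<close>

record 'a mtree =
  verts :: "'a set"
  top_vert :: 'a
  edges :: "('a \<times> 'a) set"
  height :: "'a \<Rightarrow> real"

definition rooted_tree :: "('a, 'z) mtree_scheme \<Rightarrow> bool" where
  "rooted_tree T \<longleftrightarrow>
     finite (verts T) \<and> top_vert T \<in> verts T \<and> edges T \<subseteq> verts T \<times> verts T \<and>
     (\<nexists>w. (top_vert T, w) \<in> edges T) \<and>
     (\<forall>v \<in> verts T - {top_vert T}. \<exists>!w. (v, w) \<in> edges T) \<and>
     (\<forall>v \<in> verts T. (v, top_vert T) \<in> (edges T)\<^sup>*)"

definition vle :: "('a, 'z) mtree_scheme \<Rightarrow> 'a \<Rightarrow> 'a \<Rightarrow> bool" where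
  "vle T x y \<longleftrightarrow> (x, y) \<in> (edges T)\<^sup>*"

definition vlt :: "('a, 'z) mtree_scheme \<Rightarrow> 'a \<Rightarrow> 'a \<Rightarrow> bool" where
  "vlt T x y \<longleftrightarrow> (x, y) \<in> (edges T)\<^sup>+"

definition merge_tree :: "('a, 'z) mtree_scheme \<Rightarrow> bool" where
  "merge_tree T \<longleftrightarrow>
     rooted_tree T \<and>
     card {e \<in> edges T. fst e = top_vert T \<or> snd e = top_vert T} > 1 \<and>
     inj_on (height T) (verts T) \<and>
     (\<forall>x \<in> verts T. \<forall>y \<in> verts T. vlt T x y \<longrightarrow> height T x < height T y)"

definition is_least :: "('p \<Rightarrow> 'p \<Rightarrow> bool) \<Rightarrow> 'p set \<Rightarrow> 'p \<Rightarrow> bool" where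
  "is_least le S m \<longleftrightarrow> m \<in> S \<and> (\<forall>x \<in> S. le m x)"

definition max_elems :: "('p \<Rightarrow> 'p \<Rightarrow> bool) \<Rightarrow> 'p set \<Rightarrow> 'p set" where
  "max_elems lt S = {x \<in> S. \<not> (\<exists>y \<in> S. lt x y)}"

definition LCA :: "('a, 'z) mtree_scheme \<Rightarrow> 'a set \<Rightarrow> 'a" where
  "LCA T S = (THE m. is_least (vle T) {v \<in> verts T. \<forall>s \<in> S. vle T s v} m)"


section \<open>Metric merge trees\<close>

text \<open>
  Gluing identifies the upper endpoint of the interval of an edge with the lower endpoint of the
  interval (or half-line) above it, so each point of the glued space has exactly one
  representative (v, h) in which v is the lower vertex of its edge and the upper endpoint of
  the edge is excluded. The extension of the height function to points is the second projection.
\<close>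

type_synonym 'a pt = "'a \<times> real"

definition pts :: "('a, 'z) mtree_scheme \<Rightarrow> 'a pt set" where
  "pts T = {(v, h). v \<in> verts T \<and> height T v \<le> h \<and> (\<forall>w. (v, w) \<in> edges T \<longrightarrow> h < height T w)}"

definition vpt :: "('a, 'z) mtree_scheme \<Rightarrow> 'a \<Rightarrow> 'a pt" where
  "vpt T v = (v, height T v)"

definition ple :: "('a, 'z) mtree_scheme \<Rightarrow> 'a pt \<Rightarrow> 'a pt \<Rightarrow> bool" where
  "ple T p q \<longleftrightarrow> vle T (fst p) (fst q) \<and> snd p \<le> snd q"

definition plt :: "('a, 'z) mtree_scheme \<Rightarrow> 'a pt \<Rightarrow> 'a pt \<Rightarrow> bool" where
  "plt T p q \<longleftrightarrow> ple T p q \<and> p \<noteq> q"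

text \<open>The closed edge (or, at the root, the closed half-line) with lower vertex v.\<close>

definition cell :: "('a, 'z) mtree_scheme \<Rightarrow> 'a \<Rightarrow> 'a pt set" where
  "cell T v = {p \<in> pts T. fst p = v} \<union> {vpt T w | w. (v, w) \<in> edges T}"

text \<open>
  Shortest path metric: infimum of the lengths of the finite chains of segments, each contained
  in one closed edge. The value 0 outside the space is only there because the locale
  Metric_space requires a distance which is total.
\<close>

inductive seg_path :: "('a, 'z) mtree_scheme \<Rightarrow> 'a pt \<Rightarrow> real \<Rightarrow> 'a pt \<Rightarrow> bool" for T where
  refl: "p \<in> pts T \<Longrightarrow> seg_path T p 0 p"
| step: "seg_path T p l q \<Longrightarrow> v \<in> verts T \<Longrightarrow> q \<in> cell T v \<Longrightarrow> r \<in> cell T v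
           \<Longrightarrow> seg_path T p (l + \<bar>snd r - snd q\<bar>) r"

definition tree_dist :: "('a, 'z) mtree_scheme \<Rightarrow> 'a pt \<Rightarrow> 'a pt \<Rightarrow> real" where
  "tree_dist T p q = (if p \<in> pts T \<and> q \<in> pts T then Inf {l. seg_path T p l q} else 0)"

definition tree_top :: "('a, 'z) mtree_scheme \<Rightarrow> 'a pt topology" where
  "tree_top T = Metric_space.mtopology (pts T) (tree_dist T)"

definition point_above :: "('a, 'z) mtree_scheme \<Rightarrow> 'a pt \<Rightarrow> real \<Rightarrow> 'a pt" where
  "point_above T p h = (THE q. q \<in> pts T \<and> ple T p q \<and> snd q = h)"

definition shift :: "('a, 'z) mtree_scheme \<Rightarrow> real \<Rightarrow> 'a pt \<Rightarrow> 'a pt" where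
  "shift T k p = point_above T p (snd p + k)"

definition good_map ::
  "real \<Rightarrow> ('a, 'y) mtree_scheme \<Rightarrow> ('b, 'z) mtree_scheme \<Rightarrow> ('a pt \<Rightarrow> 'b pt) \<Rightarrow> bool" where
  "good_map \<epsilon> T G \<alpha> \<longleftrightarrow>
     \<alpha> \<in> pts T \<rightarrow> pts G \<and>
     continuous_map (tree_top T) (tree_top G) \<alpha> \<and>
     (\<forall>x \<in> pts T. snd (\<alpha> x) = snd x + \<epsilon>) \<and>
     (\<forall>x \<in> pts T. \<forall>x' \<in> pts T. plt G (\<alpha> x) (\<alpha> x') \<longrightarrow>
        plt T (shift T (2 * \<epsilon>) x) (shift T (2 * \<epsilon>) x')) \<and>
     (\<forall>y \<in> pts G - \<alpha> ` pts T.
        \<exists>w. is_least (ple G) {y' \<in> \<alpha> ` pts T. plt G y y'} w \<and> snd w - snd y \<le> 2 * \<epsilon>)"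


section \<open>Couplings\<close>

text \<open>
  All notions below are written for the first tree. Their counterparts for the second tree are
  obtained by exchanging the trees and replacing C by its converse.
\<close>

definition Lam :: "('a, 'y) mtree_scheme \<Rightarrow> ('a \<times> 'b) set \<Rightarrow> 'a \<Rightarrow> 'a set" where
  "Lam T C v = max_elems (vlt T) {v' \<in> fst ` C. vlt T v' v}"

definition pair_lt ::
  "('a, 'y) mtree_scheme \<Rightarrow> ('b, 'z) mtree_scheme \<Rightarrow> 'a \<times> 'b \<Rightarrow> 'a \<times> 'b \<Rightarrow> bool" where
  "pair_lt T G p q \<longleftrightarrow> vlt T (fst p) (fst q) \<and> vlt G (snd p) (snd q)"

definition coupling ::
  "('a, 'y) mtree_scheme \<Rightarrow> ('b, 'z) mtree_scheme \<Rightarrow> ('a \<times> 'b) set \<Rightarrow> bool" where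
  "coupling T G C \<longleftrightarrow>
     C \<subseteq> verts T \<times> verts G \<and>
     card (max_elems (pair_lt T G) C) = 1 \<and>
     inj_on fst C \<and> inj_on snd C \<and>
     (\<forall>(a, b) \<in> C. \<forall>(c, d) \<in> C. vlt T a c \<longleftrightarrow> vlt G b d) \<and>
     (\<forall>a \<in> fst ` C. card (Lam T C a) \<noteq> 1) \<and>
     (\<forall>b \<in> snd ` C. card (Lam G (C\<inverse>) b) \<noteq> 1)"

definition unused :: "('a, 'y) mtree_scheme \<Rightarrow> ('a \<times> 'b) set \<Rightarrow> 'a set" where
  "unused T C = {v \<in> verts T. card (Lam T C v) = 1}"

definition deleted :: "('a, 'y) mtree_scheme \<Rightarrow> ('a \<times> 'b) set \<Rightarrow> 'a set" where
  "deleted T C = {v \<in> verts T. v \<notin> fst ` C \<and> card (Lam T C v) \<noteq> 1}"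

definition phi :: "('a, 'y) mtree_scheme \<Rightarrow> ('a \<times> 'b) set \<Rightarrow> 'a \<Rightarrow> 'a" where
  "phi T C x =
     (THE m. is_least (vle T) {v \<in> verts T. vlt T x v \<and> (\<exists>v'. vle T v' v \<and> v' \<in> fst ` C)} m)"

definition eta ::
  "('a, 'y) mtree_scheme \<Rightarrow> ('b, 'z) mtree_scheme \<Rightarrow> ('a \<times> 'b) set \<Rightarrow> 'a \<Rightarrow> 'b" where
  "eta T G C x = arg_min_on (height G) {w. \<exists>v. (v, w) \<in> C \<and> vle T v (phi T C x)}"

definition chi ::
  "('a, 'y) mtree_scheme \<Rightarrow> ('b, 'z) mtree_scheme \<Rightarrow> ('a \<times> 'b) set \<Rightarrow> 'a \<Rightarrow> 'b" where
  "chi T G C x = LCA G {w. \<exists>v. (v, w) \<in> C \<and> v \<in> Lam T C x}"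

text \<open>The values of this function at unused vertices are irrelevant.\<close>

definition vertex_map ::
  "('a, 'y) mtree_scheme \<Rightarrow> ('b, 'z) mtree_scheme \<Rightarrow> ('a \<times> 'b) set \<Rightarrow> 'a \<Rightarrow> 'b pt" where
  "vertex_map T G C x =
     (if x \<in> fst ` C then vpt G (THE y. (x, y) \<in> C)
      else if card (Lam T C x) = 0 then
        point_above G (vpt G (eta T G C x))
          (max (height G (eta T G C x)) ((height T x + height T (phi T C x)) / 2))
      else vpt G (chi T G C x))"

definition vertex_cost ::
  "('a, 'y) mtree_scheme \<Rightarrow> ('b, 'z) mtree_scheme \<Rightarrow> ('a \<times> 'b) set \<Rightarrow> real" where
  "vertex_cost T G C =
     Max ((\<lambda>x. \<bar>snd (vertex_map T G C x) - height T x\<bar>) ` (verts T - unused T C))"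

definition coupling_norm ::
  "('a, 'y) mtree_scheme \<Rightarrow> ('b, 'z) mtree_scheme \<Rightarrow> ('a \<times> 'b) set \<Rightarrow> real" where
  "coupling_norm T G C = max (vertex_cost T G C) (vertex_cost G T (C\<inverse>))"

definition low_vert :: "('a, 'y) mtree_scheme \<Rightarrow> ('a \<times> 'b) set \<Rightarrow> 'a pt \<Rightarrow> 'a" where
  "low_vert T C p =
     (let M = max_elems (vlt T) {v \<in> verts T. ple T (vpt T v) p \<and> v \<in> fst ` C \<union> deleted T C}
      in if \<exists>!v. v \<in> M then (THE v. v \<in> M) else (THE v. v \<in> M \<and> v \<in> fst ` C))"

definition shifted_vertex_map ::
  "('a, 'y) mtree_scheme \<Rightarrow> ('b, 'z) mtree_scheme \<Rightarrow> ('a \<times> 'b) set \<Rightarrow> real \<Rightarrow> 'a \<Rightarrow> 'b pt" where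
  "shifted_vertex_map T G C \<epsilon> x =
     shift G (height T x + \<epsilon> - snd (vertex_map T G C x)) (vertex_map T G C x)"

definition coupling_map ::
  "('a, 'y) mtree_scheme \<Rightarrow> ('b, 'z) mtree_scheme \<Rightarrow> ('a \<times> 'b) set \<Rightarrow> real \<Rightarrow> 'a pt \<Rightarrow> 'b pt" where
  "coupling_map T G C \<epsilon> p =
     (if p \<in> vpt T ` (verts T - unused T C) then shifted_vertex_map T G C \<epsilon> (fst p)
      else point_above G (shifted_vertex_map T G C \<epsilon> (low_vert T C p)) (snd p + \<epsilon>))"


section \<open>Basic facts on metric merge trees\<close>

lemma vlt_height:
  assumes "merge_tree T" "vlt T x y"
  shows "x \<in> verts T" "y \<in> verts T" "height T x < height T y"
proof -
  have E: "edges T \<subseteq> verts T \<times> verts T"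
    using assms(1) by (auto simp: merge_tree_def rooted_tree_def)
  have "(edges T)\<^sup>+ \<subseteq> verts T \<times> verts T"
    using trancl_subset_Sigma[OF E] .
  then show xy: "x \<in> verts T" "y \<in> verts T"
    using assms(2) by (auto simp: vlt_def)
  then show "height T x < height T y"
    using assms by (auto simp: merge_tree_def)
qed

lemma vle_iff: "vle T x y \<longleftrightarrow> x = y \<or> vlt T x y"
  by (auto simp: vle_def vlt_def rtrancl_eq_or_trancl)

lemma vle_height:
  assumes "merge_tree T" "vle T x y"
  shows "height T x \<le> height T y"
  using assms vlt_height(3)[OF assms(1)] by (fastforce simp: vle_iff)

lemma vle_trans: "vle T x y \<Longrightarrow> vle T y z \<Longrightarrow> vle T x z"
  by (auto simp: vle_def)

lemma edges_single_valued:
  assumes "merge_tree T"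
  shows "single_valued (edges T)"
proof (rule single_valuedI)
  fix x y z assume *: "(x, y) \<in> edges T" "(x, z) \<in> edges T"
  have r: "rooted_tree T" using assms by (simp add: merge_tree_def)
  then have "x \<in> verts T - {top_vert T}"
    using * by (auto simp: rooted_tree_def)
  then have "\<exists>!w. (x, w) \<in> edges T"
    using r by (simp add: rooted_tree_def)
  then show "y = z" using * by blast
qed

lemma vle_chain:
  assumes "merge_tree T" "vle T x y" "vle T x z"
  shows "vle T y z \<or> vle T z y"
  using single_valued_confluent[OF edges_single_valued[OF assms(1)]] assms(2,3)
  by (auto simp: vle_def)

lemma vlt_edge:
  assumes "merge_tree T" "vlt T x y"
  obtains w where "(x, w) \<in> edges T" "vle T w y"
  using tranclD[of x y "edges T"] assms by (auto simp: vlt_def vle_def)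

lemma pts_below_father:
  assumes "merge_tree T" "p \<in> pts T" "vlt T (fst p) v"
  shows "snd p < height T v"
proof -
  obtain w where w: "(fst p, w) \<in> edges T" "vle T w v"
    using vlt_edge[OF assms(1,3)] .
  have "snd p < height T w" using assms(2) w(1) by (auto simp: pts_def)
  also have "\<dots> \<le> height T v" using vle_height[OF assms(1) w(2)] .
  finally show ?thesis .
qed

lemma pts_height: "p \<in> pts T \<Longrightarrow> height T (fst p) \<le> snd p"
  by (auto simp: pts_def)

lemma pts_fst: "p \<in> pts T \<Longrightarrow> fst p \<in> verts T"
  by (auto simp: pts_def)

lemma vpt_in_pts:
  assumes "merge_tree T" "v \<in> verts T"
  shows "vpt T v \<in> pts T"
  using assms vlt_height(3)[OF assms(1)] by (auto simp: vpt_def pts_def vlt_def)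

lemma ple_refl: "ple T p p"
  by (simp add: ple_def vle_def)

lemma ple_trans: "ple T p q \<Longrightarrow> ple T q r \<Longrightarrow> ple T p r"
  by (auto simp: ple_def intro: vle_trans)

lemma ple_height_eq:
  assumes "merge_tree T" "p \<in> pts T" "q \<in> pts T" "ple T p q" "snd p = snd q"
  shows "p = q"
proof -
  have "fst p = fst q \<or> vlt T (fst p) (fst q)"
    using assms(4) by (auto simp: ple_def vle_iff)
  moreover have "\<not> vlt T (fst p) (fst q)"
    using pts_below_father[OF assms(1,2)] pts_height[OF assms(3)] assms(5) by fastforce
  ultimately show ?thesis using assms(5) by (simp add: prod_eq_iff)
qed

lemma ple_antisym:
  assumes "merge_tree T" "p \<in> pts T" "q \<in> pts T" "ple T p q" "ple T q p"
  shows "p = q"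
  using assms by (intro ple_height_eq) (auto simp: ple_def)

lemma ple_if_vlt:
  assumes "merge_tree T" "p \<in> pts T" "q \<in> pts T" "vlt T (fst p) (fst q)"
  shows "ple T p q"
  using pts_below_father[OF assms(1,2,4)] pts_height[OF assms(3)] assms(4)
  by (auto simp: ple_def vle_iff)

lemma ple_comparable:
  assumes "merge_tree T" "p \<in> pts T" "q \<in> pts T" "vle T (fst p) (fst q)"
  shows "ple T p q \<or> ple T q p"
  using assms ple_if_vlt[OF assms(1-3)] by (auto simp: vle_iff ple_def)

lemma ple_chain:
  assumes "merge_tree T" "q \<in> pts T" "r \<in> pts T" "ple T p q" "ple T p r"
  shows "ple T q r \<or> ple T r q"
proof -
  have "vle T (fst q) (fst r) \<or> vle T (fst r) (fst q)"
    using vle_chain[OF assms(1)] assms(4,5) by (auto simp: ple_def)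
  then show ?thesis using ple_comparable[OF assms(1)] assms(2,3) by blast
qed

lemma ple_height_cmp:
  assumes "merge_tree T" "q \<in> pts T" "r \<in> pts T" "ple T p q" "ple T p r" "snd q \<le> snd r"
  shows "ple T q r"
proof -
  consider "ple T q r" | "ple T r q" using ple_chain[OF assms(1-5)] by blast
  then show ?thesis
  proof cases
    case 2
    then have "r = q"
      using assms by (intro ple_height_eq) (auto simp: ple_def)
    then show ?thesis by (simp add: ple_refl)
  qed simp
qed

lemma point_above_ex1:
  assumes T: "merge_tree T" and p: "p \<in> pts T" and h: "snd p \<le> h"
  shows "\<exists>!q. q \<in> pts T \<and> ple T p q \<and> snd q = h"
proof -
  let ?S = "{v \<in> verts T. vle T (fst p) v \<and> height T v \<le> h}"
  have fin: "finite ?S" using T by (simp add: merge_tree_def rooted_tree_def)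
  have ne: "fst p \<in> ?S"
    using pts_height[OF p] pts_fst[OF p] h by (auto simp: vle_def)
  obtain v where v: "v \<in> ?S" and hv: "height T v = Max (height T ` ?S)"
    using Max_in[of "height T ` ?S"] fin ne
    by (metis (no_types, lifting) emptyE finite_imageI image_iff image_is_empty)
  have vmax: "height T u \<le> height T v" if "u \<in> ?S" for u
    unfolding hv by (rule Max_ge) (use fin that in blast)+
  have "h < height T w" if "(v, w) \<in> edges T" for w
  proof (rule ccontr)
    assume "\<not> h < height T w"
    moreover have lt: "vlt T v w" using that by (auto simp: vlt_def)
    ultimately have "w \<in> ?S"
      using v vlt_height(2)[OF T lt] vle_trans[of T "fst p" v w] by (auto simp: vle_iff)
    with vmax vlt_height(3)[OF T lt] show False by fastforce
  qed
  then have q: "(v, h) \<in> pts T" using v by (auto simp: pts_def)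
  have "ple T p (v, h)" using v h by (auto simp: ple_def)
  then show ?thesis
    using q ple_height_eq[OF T] ple_chain[OF T] by (metis snd_conv)
qed

lemma point_above:
  assumes "merge_tree T" "p \<in> pts T" "snd p \<le> h"
  shows "point_above T p h \<in> pts T" "ple T p (point_above T p h)" "snd (point_above T p h) = h"
  using theI'[OF point_above_ex1[OF assms]] by (auto simp: point_above_def)

lemma cell_subset_pts:
  assumes "merge_tree T"
  shows "cell T v \<subseteq> pts T"
  using assms vpt_in_pts[OF assms] by (auto simp: cell_def merge_tree_def rooted_tree_def)

lemma seg_path_pts:
  assumes "merge_tree T" "seg_path T p l q"
  shows "p \<in> pts T" "q \<in> pts T"
  using assms(2) by induction (use cell_subset_pts[OF assms(1)] in auto)

lemma seg_path_length:
  assumes "seg_path T p l q"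
  shows "\<bar>snd q - snd p\<bar> \<le> l"
  using assms by induction auto

lemma seg_path_trans:
  assumes "seg_path T p l q" "seg_path T q m r"
  shows "seg_path T p (l + m) r"
  using assms(2,1)
proof induction
  case (step q m r v s)
  then show ?case using seg_path.step[of T p "l + m" r v s] by (simp add: add.assoc)
qed simp

lemma seg_path_one:
  assumes "merge_tree T" "v \<in> verts T" "q \<in> cell T v" "r \<in> cell T v"
  shows "seg_path T q \<bar>snd r - snd q\<bar> r"
  using seg_path.step[OF seg_path.refl assms(2-4)] cell_subset_pts[OF assms(1)] assms(3) by auto

lemma seg_path_sym:
  assumes "merge_tree T" "seg_path T p l q"
  shows "seg_path T q l p"
  using assms(2)
proof induction
  case (refl p)
  then show ?case by (rule seg_path.refl)
next
  case (step p l q v r)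
  have "seg_path T r \<bar>snd q - snd r\<bar> q"
    using seg_path_one[OF assms(1)] step by blast
  from seg_path_trans[OF this step.IH] show ?case
    by (simp add: add.commute abs_minus_commute)
qed

lemma seg_path_up:
  assumes T: "merge_tree T" and p: "p \<in> pts T" and q: "q \<in> pts T" and pq: "ple T p q"
  shows "seg_path T p (snd q - snd p) q"
proof -
  have "(fst p, fst q) \<in> (edges T)\<^sup>*" using pq by (simp add: ple_def vle_def)
  then have "\<forall>h. (fst p, h) \<in> pts T \<longrightarrow> h \<le> snd q \<longrightarrow> seg_path T (fst p, h) (snd q - h) q"
  proof (induction rule: converse_rtrancl_induct)
    case base
    show ?case
    proof (intro allI impI)
      fix h assume h: "(fst q, h) \<in> pts T" "h \<le> snd q"
      then have "seg_path T (fst q, h) \<bar>snd q - snd (fst q, h)\<bar> q"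
        using q pts_fst[OF q] by (intro seg_path_one[OF T]) (auto simp: cell_def)
      then show "seg_path T (fst q, h) (snd q - h) q" using h by simp
    qed
  next
    case (step v w)
    show ?case
    proof (intro allI impI)
      fix h assume h: "(v, h) \<in> pts T" "h \<le> snd q"
      have lt: "vlt T v w" using step by (auto simp: vlt_def)
      have w: "w \<in> verts T" "v \<in> verts T" using vlt_height[OF T lt] by auto
      have 1: "seg_path T (v, h) \<bar>snd (vpt T w) - snd (v, h)\<bar> (vpt T w)"
        using h w step by (intro seg_path_one[OF T, of v]) (auto simp: cell_def)
      have "h < height T w" using pts_below_father[OF T h(1)] lt by simp
      moreover have "height T w \<le> snd q"
        using vle_height[OF T, of w "fst q"] step pts_height[OF q] by (auto simp: vle_def)
      moreover have "(w, height T w) \<in> pts T" using vpt_in_pts[OF T w(1)] by (simp add: vpt_def)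
      ultimately have 2: "seg_path T (vpt T w) (snd q - height T w) q"
        using step.IH by (auto simp: vpt_def)
      from seg_path_trans[OF 1 2] \<open>h < height T w\<close> show "seg_path T (v, h) (snd q - h) q"
        by (simp add: vpt_def)
    qed
  qed
  then show ?thesis using p pq by (cases p) (auto simp: ple_def)
qed

lemma top_vert_ge:
  assumes "merge_tree T" "v \<in> verts T"
  shows "vle T v (top_vert T)"
  using assms by (auto simp: merge_tree_def rooted_tree_def vle_def)

lemma common_upper_point:
  assumes T: "merge_tree T" and p: "p \<in> pts T" and q: "q \<in> pts T"
  obtains r where "r \<in> pts T" "ple T p r" "ple T q r"
proof -
  let ?t = "top_vert T"
  have t: "?t \<in> verts T" "\<And>w. (?t, w) \<notin> edges T"
    using T by (auto simp: merge_tree_def rooted_tree_def)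
  let ?r = "(?t, max (height T ?t) (max (snd p) (snd q)))"
  have "?r \<in> pts T" "ple T p ?r" "ple T q ?r"
    using t top_vert_ge[OF T] pts_fst[OF p] pts_fst[OF q] by (auto simp: pts_def ple_def)
  then show ?thesis using that by blast
qed

lemma seg_path_ex:
  assumes T: "merge_tree T" and p: "p \<in> pts T" and q: "q \<in> pts T"
  shows "\<exists>l. seg_path T p l q"
proof -
  obtain r where r: "r \<in> pts T" "ple T p r" "ple T q r"
    using common_upper_point[OF assms] .
  then show ?thesis
    using seg_path_trans[OF seg_path_up[OF T p r(1,2)] seg_path_sym[OF T seg_path_up[OF T q r(1,3)]]]
    by blast
qed

lemma cell_comparable:
  assumes T: "merge_tree T" and "q \<in> cell T v" "r \<in> cell T v" "snd q \<le> snd r"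
  shows "ple T q r"
proof -
  have mem: "q \<in> pts T" "r \<in> pts T" using cell_subset_pts[OF T] assms by auto
  have *: "ple T (vpt T v) x" if "x \<in> cell T v" for x
    using that pts_height[of x T] vlt_height(3)[OF T, of v]
    by (fastforce simp: cell_def ple_def vpt_def vle_iff vlt_def)
  show ?thesis using ple_height_cmp[OF T mem *[OF assms(2)] *[OF assms(3)] assms(4)] .
qed

text \<open>A path joining incomparable points has to leave the points above p through a vertex.\<close>

lemma seg_path_leaves:
  assumes T: "merge_tree T" and p: "p \<in> pts T"
    and path: "seg_path T p l q" and inc: "\<not> ple T p q" "\<not> ple T q p"
  shows "\<exists>u \<in> verts T. snd p < height T u \<and> height T u - snd p \<le> l"
  using path p inc
proof induction
  case (refl p)
  then show ?case by (simp add: ple_refl)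
next
  case (step p l q v r)
  have mem: "q \<in> pts T" "r \<in> pts T" using cell_subset_pts[OF T] step by auto
  show ?case
  proof (cases "ple T p q \<or> ple T q p")
    case False
    then obtain u where "u \<in> verts T" "snd p < height T u" "height T u - snd p \<le> l"
      using step by blast
    then show ?thesis by (intro bexI[of _ u]) auto
  next
    case True
    have ql: "\<bar>snd q - snd p\<bar> \<le> l" using seg_path_length step.hyps(1) .
    have cmp: "ple T q r \<or> ple T r q"
      using cell_comparable[OF T] step(3,4) by (meson linear)
    show ?thesis
    proof (cases "ple T q p")
      case True
      then show ?thesis
        using cmp step.prems ple_chain[OF T step.prems(1) mem(2)] ple_trans by blast
    next
      case False
      with \<open>ple T p q \<or> ple T q p\<close> have pq: "ple T p q" by simp
      have nqr: "\<not> ple T q r" using pq step.prems ple_trans by blast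
      have nvle: "\<not> vle T (fst p) (fst r)"
        using ple_comparable[OF T step.prems(1) mem(2)] step.prems by blast
      have "vle T (fst p) (fst q)" using pq by (simp add: ple_def)
      with nvle have ne: "fst p \<noteq> fst r" "fst q \<noteq> fst r" by (auto simp: vle_def)
      have "q = vpt T (fst q)"
      proof -
        have "q \<in> {vpt T w | w. (v, w) \<in> edges T}"
        proof (rule ccontr)
          assume "\<not> ?thesis"
          then have fq: "fst q = v" using step(3) by (auto simp: cell_def)
          then obtain w where "(v, w) \<in> edges T" "r = vpt T w"
            using step(4) ne by (auto simp: cell_def)
          then have "vlt T (fst q) (fst r)" using fq by (auto simp: vlt_def vpt_def)
          then show False using ple_if_vlt[OF T mem] nqr by blast
        qed
        then show ?thesis by (auto simp: vpt_def)
      qed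
      then have hq: "height T (fst q) = snd q" by (metis snd_conv vpt_def)
      have "snd p \<noteq> snd q"
        using False ple_height_eq[OF T step.prems(1) mem(1) pq] ple_refl by metis
      then have "snd p < snd q" using pq by (auto simp: ple_def)
      then show ?thesis
        using hq ql pts_fst[OF mem(1)] by (intro bexI[of _ "fst q"]) auto
    qed
  qed
qed

lemma tree_dist_le:
  assumes "merge_tree T" "seg_path T p l q"
  shows "tree_dist T p q \<le> l"
proof -
  have "bdd_below {l. seg_path T p l q}"
    using seg_path_length by (intro bdd_belowI[of _ 0]) fastforce
  then show ?thesis
    using assms seg_path_pts[OF assms] by (auto simp: tree_dist_def intro!: cInf_lower)
qed

lemma tree_dist_ge:
  assumes "merge_tree T" "p \<in> pts T" "q \<in> pts T" "\<And>l. seg_path T p l q \<Longrightarrow> c \<le> l"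
  shows "c \<le> tree_dist T p q"
  using assms seg_path_ex[OF assms(1-3)] by (auto simp: tree_dist_def intro!: cInf_greatest)

lemma tree_dist_pos:
  assumes T: "merge_tree T" and p: "p \<in> pts T" and q: "q \<in> pts T" and "p \<noteq> q"
  shows "0 < tree_dist T p q"
proof (cases "ple T p q \<or> ple T q p")
  case True
  then have "snd p \<noteq> snd q"
    using ple_height_eq[OF T p q] ple_height_eq[OF T q p] \<open>p \<noteq> q\<close> by auto
  moreover have "\<bar>snd q - snd p\<bar> \<le> tree_dist T p q"
    using tree_dist_ge[OF T p q] seg_path_length by blast
  ultimately show ?thesis by linarith
next
  case False
  let ?U = "(\<lambda>u. height T u - snd p) ` {u \<in> verts T. snd p < height T u}"
  have fin: "finite ?U" using T by (simp add: merge_tree_def rooted_tree_def)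
  obtain l where "seg_path T p l q" using seg_path_ex[OF T p q] by blast
  then have ne: "?U \<noteq> {}" using seg_path_leaves[OF T p] False by blast
  have "Min ?U \<le> tree_dist T p q"
  proof (rule tree_dist_ge[OF T p q])
    fix l assume "seg_path T p l q"
    then obtain u where u: "u \<in> verts T" "snd p < height T u" "height T u - snd p \<le> l"
      using seg_path_leaves[OF T p] False by blast
    then have "Min ?U \<le> height T u - snd p" using fin by (intro Min_le) auto
    then show "Min ?U \<le> l" using u by simp
  qed
  moreover have "0 < Min ?U" using fin ne by (subst Min_gr_iff) auto
  ultimately show ?thesis by simp
qed

theorem Metric_space_tree:
  assumes T: "merge_tree T"
  shows "Metric_space (pts T) (tree_dist T)"
proof
  show nonneg: "0 \<le> tree_dist T x y" for x y
  proof (cases "x \<in> pts T \<and> y \<in> pts T")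
    case True
    then show ?thesis using tree_dist_ge[OF T, of x y 0] seg_path_length by fastforce
  qed (auto simp: tree_dist_def)
  have "{l. seg_path T x l y} = {l. seg_path T y l x}" for x y
    using seg_path_sym[OF T] by blast
  then show "tree_dist T x y = tree_dist T y x" for x y
    by (auto simp: tree_dist_def)
  show "tree_dist T x y = 0 \<longleftrightarrow> x = y" if "x \<in> pts T" "y \<in> pts T" for x y
    using tree_dist_pos[OF T that] tree_dist_le[OF T seg_path.refl[OF that(1)]] nonneg[of x x]
    by force
  show "tree_dist T x z \<le> tree_dist T x y + tree_dist T y z"
    if xyz: "x \<in> pts T" "y \<in> pts T" "z \<in> pts T" for x y z
  proof -
    have "tree_dist T x z - tree_dist T y z \<le> l" if l: "seg_path T x l y" for l
    proof -
      have "tree_dist T x z - l \<le> m" if "seg_path T y m z" for m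
        using tree_dist_le[OF T seg_path_trans[OF l that]] by simp
      then have "tree_dist T x z - l \<le> tree_dist T y z" by (rule tree_dist_ge[OF T xyz(2,3)])
      then show ?thesis by simp
    qed
    then have "tree_dist T x z - tree_dist T y z \<le> tree_dist T x y"
      by (rule tree_dist_ge[OF T xyz(1,2)])
    then show ?thesis by simp
  qed
qed

end

theory Submission
  imports Defs
begin

text \<open>
  The image of a point \<^term>\<open>(v, h)\<close> is the point at height \<^term>\<open>h + \<epsilon>\<close> above a
  point of the second tree that depends on \<^term>\<open>v\<close> only: the value of the vertex map at
  \<^term>\<open>v\<close> itself or, if \<^term>\<open>v\<close> is unused, at the only maximal coupled vertex below it
  (\<open>coupling_map_eq\<close>). Two points of a merge tree with a common lower bound are compared by
  their heights alone, and the map raises all heights by the same \<^term>\<open>\<epsilon>\<close>. Hence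
  order relations in the image reduce to finding one common lower bound.

  Two consequences carry the proof. The map is monotone (\<open>coupling_map_mono\<close>). So it maps each
  edge isometrically into a chain and does not increase the lengths of paths, which makes it
  1-Lipschitz and hence continuous. Next, the hypotheses are symmetric in the two trees, so there
  is a map in the opposite direction with the same properties, and the two composites are the
  shifts by \<^term>\<open>2 * \<epsilon>\<close> (\<open>coupling_map_round_trip\<close>). By monotonicity it is enough to see that
  the composite sends a vertex \<^term>\<open>v\<close> to a point above \<^term>\<open>v\<close>. If there is a pair
  \<open>(c, d)\<close> of the coupling with \<open>c \<le> v\<close>, then going forth from \<open>c\<close> leads above \<open>d\<close> and going
  back from \<open>d\<close> leads above \<open>c\<close>. If there is none, the vertex lies in a branch that is deleted
  altogether, and the height \<open>(f v + f (\<phi> v)) / 2\<close> in the definition of the vertex map forces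
  \<open>f (\<phi> v) \<le> f v + 2 * \<epsilon>\<close>: the round trip rises far enough to get past the point at which the
  branch is attached, and above that point \<^term>\<open>v\<close> can no longer be told apart from a coupled
  vertex.

  Both remaining conditions are formal consequences. Going back along the opposite map turns
  \<open>\<alpha> p \<le> \<alpha> q\<close> into the corresponding relation for the points shifted by \<^term>\<open>2 * \<epsilon>\<close>. The
  other composite shows that every point shifted by \<^term>\<open>2 * \<epsilon>\<close> is in the image. Finally, the
  image is the upward closure of finitely many points, so the image points above a given point
  have a least one.
\<close>

section \<open>Least elements in merge trees\<close>

lemma vle_antisym:
  assumes "merge_tree T" "vle T x y" "vle T y x"
  shows "x = y"
  using vlt_height(3)[OF assms(1)] vle_height[OF assms(1)] assms(2,3)
  by (fastforce simp: vle_iff)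

lemma vlt_irrefl: "merge_tree T \<Longrightarrow> \<not> vlt T x x"
  using vlt_height(3) by fastforce

lemma vlt_vle_trans: "vlt T x y \<Longrightarrow> vle T y z \<Longrightarrow> vlt T x z"
  by (auto simp: vle_def vlt_def)

lemma vle_vlt_trans: "vle T x y \<Longrightarrow> vlt T y z \<Longrightarrow> vlt T x z"
  by (auto simp: vle_def vlt_def)

lemma finite_verts: "merge_tree T \<Longrightarrow> finite (verts T)"
  by (simp add: merge_tree_def rooted_tree_def)

lemma top_vert_in_verts: "merge_tree T \<Longrightarrow> top_vert T \<in> verts T"
  by (simp add: merge_tree_def rooted_tree_def)

lemma ex_min_on:
  fixes f :: "'c \<Rightarrow> 'd :: linorder"
  assumes "finite X" "X \<noteq> {}"
  shows "\<exists>m \<in> X. \<forall>u \<in> X. f m \<le> f u"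
  using ex_is_arg_min_if_finite[OF assms, of f] by (auto simp: is_arg_min_def not_less)

text \<open>Vertices with a common lower bound form a chain, which has a least element if it is finite.\<close>

lemma is_least_The_vle:
  assumes T: "merge_tree T" and X: "X \<subseteq> verts T" "X \<noteq> {}" and lb: "\<And>u. u \<in> X \<Longrightarrow> vle T x u"
  shows "is_least (vle T) X (THE m. is_least (vle T) X m)"
proof -
  have "finite X" using finite_subset[OF X(1) finite_verts[OF T]] .
  then obtain m where m: "m \<in> X" "\<And>u. u \<in> X \<Longrightarrow> height T m \<le> height T u"
    using ex_min_on[of X "height T"] X(2) by blast
  have "vle T m u" if "u \<in> X" for u
  proof -
    have "vle T m u \<or> vle T u m" using vle_chain[OF T lb[OF m(1)] lb[OF that]] .
    moreover have "\<not> vlt T u m" using vlt_height(3)[OF T, of u m] m(2)[OF that] by fastforce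
    ultimately show ?thesis by (auto simp: vle_iff)
  qed
  then have "is_least (vle T) X m" using m by (simp add: is_least_def)
  then show ?thesis
    by (rule theI) (use vle_antisym[OF T] \<open>is_least (vle T) X m\<close> in \<open>auto simp: is_least_def\<close>)
qed

lemma is_least_LCA:
  assumes "merge_tree T" "S \<subseteq> verts T" "S \<noteq> {}"
  shows "is_least (vle T) {v \<in> verts T. \<forall>s \<in> S. vle T s v} (LCA T S)"
proof -
  obtain s where "s \<in> S" using assms by blast
  moreover have "top_vert T \<in> {v \<in> verts T. \<forall>s \<in> S. vle T s v}"
    using assms(2) top_vert_ge[OF assms(1)] top_vert_in_verts[OF assms(1)] by blast
  ultimately show ?thesis
    unfolding LCA_def by (intro is_least_The_vle[OF assms(1), where x = s]) blast+
qed

lemma ple_vpt_iff: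
  assumes "merge_tree T" "p \<in> pts T"
  shows "ple T (vpt T v) p \<longleftrightarrow> vle T v (fst p)"
  using vle_height[OF assms(1), of v "fst p"] pts_height[OF assms(2)]
  by (auto simp: ple_def vpt_def)

lemma point_above_eqI:
  assumes "merge_tree T" "p \<in> pts T" "q \<in> pts T" "ple T p q" "snd q = h"
  shows "point_above T p h = q"
  using point_above_ex1[OF assms(1,2), of h] point_above[OF assms(1,2), of h] assms(3-5)
  by (metis ple_def)

text \<open>
  The points in question form a chain, which need not be finite. But every point above y and some
  a in A is above a point of the set that is a vertex or belongs to A: if a is above y, this is a,
  and otherwise y and a are incomparable and their branches join at a vertex. So it is enough to
  take the lowest among finitely many points.
\<close>

lemma ex_least_point_above:
  assumes T: "merge_tree T" and A: "finite A" "A \<subseteq> pts T" and y: "y \<in> pts T"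
    and S_def: "S = {z \<in> pts T. \<exists>a \<in> A. ple T a z}"
    and "y \<notin> S" and z0: "z0 \<in> S" "ple T y z0"
  shows "\<exists>w. is_least (ple T) {z \<in> S. plt T y z} w"
proof -
  let ?F = "(vpt T ` verts T \<union> A) \<inter> {z \<in> S. ple T y z}"
  have finF: "finite ?F" using A finite_verts[OF T] by blast
  have dom: "\<exists>x \<in> ?F. ple T x z" if z: "z \<in> S" "ple T y z" for z
  proof -
    obtain a where a: "a \<in> A" "ple T a z" "a \<in> pts T" and zp: "z \<in> pts T"
      using z A by (auto simp: S_def)
    have "\<not> ple T a y" using \<open>y \<notin> S\<close> y a by (auto simp: S_def)
    show ?thesis
    proof (cases "ple T y a")
      case True
      then have "a \<in> ?F" using a ple_refl[of T a] unfolding S_def by blast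
      then show ?thesis using a by blast
    next
      case False
      (* If z were on the same edge as y or a, then y and a would be comparable. *)
      let ?u = "vpt T (fst z)"
      have u: "?u \<in> pts T" using vpt_in_pts[OF T pts_fst[OF zp]] .
      have uz: "ple T ?u z" using pts_height[OF zp] by (auto simp: ple_def vpt_def vle_def)
      have "vle T (fst y) (fst z)" "vle T (fst a) (fst z)" using z a by (auto simp: ple_def)
      moreover have "\<not> vle T (fst y) (fst a)" "\<not> vle T (fst a) (fst y)"
        using ple_comparable[OF T y a(3)] ple_comparable[OF T a(3) y] False \<open>\<not> ple T a y\<close> by blast+
      ultimately have "vlt T (fst y) (fst ?u)" "vlt T (fst a) (fst ?u)"
        by (auto simp: vle_iff vpt_def)
      then have "ple T y ?u" "ple T a ?u"
        using ple_if_vlt[OF T y u] ple_if_vlt[OF T a(3) u] by blast+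
      then have "?u \<in> ?F" using u a(1) pts_fst[OF zp] unfolding S_def by blast
      then show ?thesis using uz by blast
    qed
  qed
  have "?F \<noteq> {}" using dom[OF z0] by blast
  then obtain w where w: "w \<in> ?F" "\<And>x. x \<in> ?F \<Longrightarrow> snd w \<le> snd x"
    using ex_min_on[OF finF, of snd] by blast
  have "ple T w z" if z: "z \<in> S" "ple T y z" for z
  proof -
    obtain x where x: "x \<in> ?F" "ple T x z" using dom[OF z] by blast
    have "w \<in> pts T" "x \<in> pts T" "ple T y w" "ple T y x"
      using w(1) x(1) unfolding S_def by blast+
    then have "ple T w x" using ple_height_cmp[OF T _ _ _ _ w(2)[OF x(1)]] by blast
    then show ?thesis using x(2) ple_trans by blast
  qed
  moreover have "w \<in> S" "plt T y w" using w(1) \<open>y \<notin> S\<close> unfolding plt_def by blast+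
  ultimately have "is_least (ple T) {z \<in> S. plt T y z} w"
    unfolding is_least_def plt_def by blast
  then show ?thesis by blast
qed

section \<open>Monotone maps that raise all heights by the same amount\<close>

lemma tree_dist_mono_map:
  assumes T: "merge_tree T" and G: "merge_tree G" and maps: "\<alpha> \<in> pts T \<rightarrow> pts G"
    and raise: "\<And>p. p \<in> pts T \<Longrightarrow> snd (\<alpha> p) = snd p + k"
    and mono: "\<And>p q. p \<in> pts T \<Longrightarrow> q \<in> pts T \<Longrightarrow> ple T p q \<Longrightarrow> ple G (\<alpha> p) (\<alpha> q)"
    and pq: "p \<in> pts T" "q \<in> pts T"
  shows "tree_dist G (\<alpha> p) (\<alpha> q) \<le> tree_dist T p q"
proof (rule tree_dist_ge[OF T pq])
  fix l assume "seg_path T p l q"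
  then have "seg_path G (\<alpha> p) l (\<alpha> q)"
  proof induction
    case (refl p)
    then show ?case using maps by (auto intro: seg_path.refl)
  next
    case (step p l q v r)
    have mem: "q \<in> pts T" "r \<in> pts T" using cell_subset_pts[OF T] step by auto
    have up: "seg_path G (\<alpha> a) (snd b - snd a) (\<alpha> b)"
      if "a \<in> pts T" "b \<in> pts T" "ple T a b" for a b
    proof -
      have "\<alpha> a \<in> pts G" "\<alpha> b \<in> pts G" using maps that by auto
      from seg_path_up[OF G this mono[OF that]] show ?thesis using raise that by simp
    qed
    have "seg_path G (\<alpha> q) \<bar>snd r - snd q\<bar> (\<alpha> r)"
    proof (cases "snd q \<le> snd r")
      case True
      then show ?thesis using up[OF mem] cell_comparable[OF T step(3,4)] by simp
    next
      case False
      then show ?thesis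
        using seg_path_sym[OF G up[OF mem(2,1)]] cell_comparable[OF T step(4,3)] by simp
    qed
    then show ?case using seg_path_trans step.IH by blast
  qed
  then show "tree_dist G (\<alpha> p) (\<alpha> q) \<le> l" by (rule tree_dist_le[OF G])
qed

lemma continuous_mono_map:
  assumes T: "merge_tree T" and G: "merge_tree G" and maps: "\<alpha> \<in> pts T \<rightarrow> pts G"
    and raise: "\<And>p. p \<in> pts T \<Longrightarrow> snd (\<alpha> p) = snd p + k"
    and mono: "\<And>p q. p \<in> pts T \<Longrightarrow> q \<in> pts T \<Longrightarrow> ple T p q \<Longrightarrow> ple G (\<alpha> p) (\<alpha> q)"
  shows "continuous_map (tree_top T) (tree_top G) \<alpha>"
proof -
  have "\<exists>\<delta>>0. \<forall>x. x \<in> pts T \<and> tree_dist T a x < \<delta> \<longrightarrow> tree_dist G (\<alpha> a) (\<alpha> x) < e"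
    if "a \<in> pts T" "0 < e" for a e
    using that tree_dist_mono_map[OF T G maps raise mono] by (meson le_less_trans)
  then show ?thesis
    unfolding tree_top_def
    using maps by (auto simp: Metric_space.metric_continuous_map[OF Metric_space_tree[OF T]
        Metric_space_tree[OF G]])
qed

text \<open>
  A point above the image of a vertex is hit because one can climb from the vertex to the right
  height; by monotonicity the image climbs to the given point.
\<close>

lemma image_mono_map:
  assumes T: "merge_tree T" and G: "merge_tree G" and maps: "\<alpha> \<in> pts T \<rightarrow> pts G"
    and raise: "\<And>p. p \<in> pts T \<Longrightarrow> snd (\<alpha> p) = snd p + k"
    and mono: "\<And>p q. p \<in> pts T \<Longrightarrow> q \<in> pts T \<Longrightarrow> ple T p q \<Longrightarrow> ple G (\<alpha> p) (\<alpha> q)"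
  shows "\<alpha> ` pts T = {z \<in> pts G. \<exists>a \<in> (\<lambda>v. \<alpha> (vpt T v)) ` verts T. ple G a z}"
proof (intro equalityI subsetI)
  fix z assume "z \<in> \<alpha> ` pts T"
  then obtain p where p: "p \<in> pts T" "z = \<alpha> p" by blast
  have "ple T (vpt T (fst p)) p" using ple_vpt_iff[OF T p(1)] by (simp add: vle_def)
  then have "ple G (\<alpha> (vpt T (fst p))) z"
    using mono p vpt_in_pts[OF T pts_fst[OF p(1)]] by blast
  then show "z \<in> {z \<in> pts G. \<exists>a \<in> (\<lambda>v. \<alpha> (vpt T v)) ` verts T. ple G a z}"
    using p maps pts_fst[OF p(1)] by blast
next
  fix z assume "z \<in> {z \<in> pts G. \<exists>a \<in> (\<lambda>v. \<alpha> (vpt T v)) ` verts T. ple G a z}"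
  then obtain v where v: "z \<in> pts G" "v \<in> verts T" "ple G (\<alpha> (vpt T v)) z" by blast
  have vp: "vpt T v \<in> pts T" using vpt_in_pts[OF T v(2)] .
  define q where "q = point_above T (vpt T v) (snd z - k)"
  have "snd (vpt T v) \<le> snd z - k" using v(3) raise[OF vp] by (simp add: ple_def)
  note q = point_above[OF T vp this, folded q_def]
  have q': "\<alpha> q \<in> pts G" and hq: "snd (\<alpha> q) = snd z" using maps q raise[OF q(1)] by auto
  have "ple G (\<alpha> q) z"
    using ple_height_cmp[OF G q' v(1) mono[OF vp q(1,2)] v(3)] hq by simp
  then have "\<alpha> q = z"
    using ple_height_eq[OF G q' v(1)] hq by blast
  then show "z \<in> \<alpha> ` pts T" using q(1) by blast
qed

section \<open>Coupled vertices below a given vertex\<close>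

lemma Lam_D:
  assumes "a \<in> Lam T C v"
  shows "a \<in> fst ` C" "vlt T a v"
  using assms by (auto simp: Lam_def max_elems_def)

lemma finite_Lam:
  assumes T: "merge_tree T"
  shows "finite (Lam T C v)"
proof (rule finite_subset)
  show "Lam T C v \<subseteq> verts T" using vlt_height(1)[OF T Lam_D(2)] by blast
qed (rule finite_verts[OF T])

lemma ex_Lam_above:
  assumes T: "merge_tree T" and c: "c \<in> fst ` C" "vlt T c v"
  shows "\<exists>a \<in> Lam T C v. vle T c a"
proof -
  let ?X = "{a \<in> fst ` C. vle T c a \<and> vlt T a v}"
  have "?X \<subseteq> verts T" using vlt_height(1)[OF T] by blast
  then have "finite ?X" using finite_subset finite_verts[OF T] by blast
  moreover have "c \<in> ?X" using c by (auto simp: vle_def)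
  ultimately have "\<exists>a \<in> ?X. \<forall>b \<in> ?X. - height T a \<le> - height T b" by (intro ex_min_on) blast+
  then obtain a where a: "a \<in> ?X" "\<forall>b \<in> ?X. - height T a \<le> - height T b" by blast
  have "\<not> vlt T a b" if "b \<in> fst ` C" "vlt T b v" for b
  proof
    assume "vlt T a b"
    then have "b \<in> ?X" using a(1) that vle_trans[of T c a b] by (auto simp: vle_iff)
    with a(2) have "- height T a \<le> - height T b" by (rule bspec)
    then show False using vlt_height(3)[OF T \<open>vlt T a b\<close>] by simp
  qed
  then have "a \<in> Lam T C v" using a(1) unfolding Lam_def max_elems_def by blast
  then show ?thesis using a(1) by blast
qed

text \<open>
  The vertex whose image determines the images of all points on the edge above a vertex.
\<close>

definition anchor :: "('a, 'y) mtree_scheme \<Rightarrow> ('a \<times> 'b) set \<Rightarrow> 'a \<Rightarrow> 'a" where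
  "anchor T C v = (if v \<in> unused T C then the_elem (Lam T C v) else v)"

definition base_point ::
  "('a, 'y) mtree_scheme \<Rightarrow> ('b, 'z) mtree_scheme \<Rightarrow> ('a \<times> 'b) set \<Rightarrow> 'a \<Rightarrow> 'b pt" where
  "base_point T G C v = vertex_map T G C (anchor T C v)"

lemma unused_anchor:
  assumes "v \<in> unused T C"
  shows "Lam T C v = {anchor T C v}"
proof -
  have "card (Lam T C v) = 1" using assms by (simp add: unused_def)
  then obtain a where "Lam T C v = {a}" by (rule card_1_singletonE)
  then show ?thesis using assms by (simp add: anchor_def)
qed

section \<open>The map induced by a coupling\<close>

lemma coupling_converse:
  assumes C: "coupling T G C"
  shows "coupling G T (C\<inverse>)"
proof -
  have max: "max_elems (pair_lt G T) (C\<inverse>) = prod.swap ` max_elems (pair_lt T G) C"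
    by (force simp: max_elems_def pair_lt_def)
  have "card (max_elems (pair_lt G T) (C\<inverse>)) = card (max_elems (pair_lt T G) C)"
    unfolding max by (rule card_image) simp
  also have "\<dots> = 1" using C by (simp add: coupling_def)
  finally have card: "card (max_elems (pair_lt G T) (C\<inverse>)) = 1" .
  have sub: "C\<inverse> \<subseteq> verts G \<times> verts T" using C unfolding coupling_def by blast
  have "inj_on fst C" "inj_on snd C" using C by (simp_all add: coupling_def)
  then have inj: "inj_on fst (C\<inverse>)" "inj_on snd (C\<inverse>)"
    by (auto simp: inj_on_def Ball_def)
  have order: "\<forall>(a, b) \<in> C\<inverse>. \<forall>(c, d) \<in> C\<inverse>. vlt G a c \<longleftrightarrow> vlt T b d"
    using C unfolding coupling_def by blast
  have "fst ` (C\<inverse>) = snd ` C" "snd ` (C\<inverse>) = fst ` C" by force+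
  then have "\<forall>b \<in> fst ` (C\<inverse>). card (Lam G (C\<inverse>) b) \<noteq> 1"
    "\<forall>a \<in> snd ` (C\<inverse>). card (Lam T ((C\<inverse>)\<inverse>) a) \<noteq> 1"
    using C unfolding coupling_def converse_converse by metis+
  then show ?thesis
    unfolding coupling_def using card sub inj order by blast
qed

locale bounded_coupling =
  fixes T :: "('a, 'y) mtree_scheme" and G :: "('b, 'z) mtree_scheme"
    and C :: "('a \<times> 'b) set" and \<epsilon> :: real
  assumes T: "merge_tree T" and G: "merge_tree G" and C: "coupling T G C"
    and bound: "coupling_norm T G C \<le> \<epsilon>"
begin

lemma dual: "bounded_coupling G T (C\<inverse>) \<epsilon>"
  using T G bound coupling_converse[OF C]
  by unfold_locales (auto simp: coupling_norm_def max.commute)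

lemma pair_verts:
  assumes "(c, d) \<in> C"
  shows "c \<in> verts T" "d \<in> verts G"
  using assms C by (auto simp: coupling_def)

lemma coupling_inj: "inj_on fst C" "inj_on snd C"
  using C by (simp_all add: coupling_def)

lemma pair_eq_iff:
  assumes "(a, b) \<in> C" "(c, d) \<in> C"
  shows "a = c \<longleftrightarrow> b = d"
  using inj_onD[OF coupling_inj(1) _ assms] inj_onD[OF coupling_inj(2) _ assms] by auto

lemma pair_vle_iff:
  assumes "(a, b) \<in> C" "(c, d) \<in> C"
  shows "vle T a c \<longleftrightarrow> vle G b d"
proof -
  have "vlt T a c \<longleftrightarrow> vlt G b d" using assms C by (auto simp: coupling_def)
  then show ?thesis using pair_eq_iff[OF assms] by (simp add: vle_iff)
qed

lemma coupled_not_unused: "(c, d) \<in> C \<Longrightarrow> c \<notin> unused T C"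
  using C by (force simp: coupling_def unused_def)

lemma verts_not_unused: "fst ` C \<union> deleted T C = verts T - unused T C"
  using pair_verts(1) coupled_not_unused by (force simp: deleted_def unused_def)

lemma vertex_map_coupled:
  assumes "(c, d) \<in> C"
  shows "vertex_map T G C c = vpt G d"
proof -
  have "(THE y. (c, y) \<in> C) = d"
    using assms pair_eq_iff[OF assms] by (intro the_equality) auto
  moreover have "c \<in> fst ` C" using assms by (rule image_eqI[rotated]) simp
  ultimately show ?thesis by (simp add: vertex_map_def)
qed

lemma ex_pair: "\<exists>c d. (c, d) \<in> C"
proof -
  have "max_elems (pair_lt T G) C \<noteq> {}" using C unfolding coupling_def by fastforce
  then show ?thesis unfolding max_elems_def by force
qed

lemma phi_least:
  assumes "v \<in> verts T" "\<forall>c \<in> fst ` C. \<not> vle T c v"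
  shows "is_least (vle T) {u \<in> verts T. vlt T v u \<and> (\<exists>c. vle T c u \<and> c \<in> fst ` C)} (phi T C v)"
  unfolding phi_def
proof (rule is_least_The_vle[OF T, where x = v])
  obtain c d where c: "(c, d) \<in> C" using ex_pair by blast
  have "vle T c (top_vert T)" "vle T v (top_vert T)"
    using top_vert_ge[OF T] pair_verts[OF c] assms(1) by auto
  moreover have "v \<noteq> top_vert T" using assms(2) c calculation by force
  ultimately show "{u \<in> verts T. vlt T v u \<and> (\<exists>c. vle T c u \<and> c \<in> fst ` C)} \<noteq> {}"
    using c top_vert_in_verts[OF T] by (force simp: vle_iff)
qed (auto simp: vle_iff)

lemma eta_pair:
  assumes "v \<in> verts T" "\<forall>c \<in> fst ` C. \<not> vle T c v"
  shows "\<exists>c. (c, eta T G C v) \<in> C \<and> vle T c (phi T C v)"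
proof -
  let ?W = "{w. \<exists>c. (c, w) \<in> C \<and> vle T c (phi T C v)}"
  have "?W \<subseteq> verts G" using pair_verts by blast
  then have "finite ?W" using finite_subset finite_verts[OF G] by blast
  moreover have "\<exists>c \<in> fst ` C. vle T c (phi T C v)"
    using phi_least[OF assms] unfolding is_least_def by blast
  then have "?W \<noteq> {}" by force
  ultimately have "eta T G C v \<in> ?W"
    unfolding eta_def by (rule arg_min_if_finite(1))
  then show ?thesis by simp
qed

text \<open>
  All that matters about the image of a vertex in a branch that is deleted altogether is which
  coupled vertex it lies above and that it is at least as high as the middle between the vertex
  and the point at which the branch is attached. The latter makes the cost at the vertex at least
  half the height of the branch above it.
\<close>

lemma vertex_map_deleted_branch:
  assumes v: "v \<in> verts T" and none: "\<forall>c \<in> fst ` C. \<not> vle T c v"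
  shows "v \<in> verts T - unused T C"
    "vertex_map T G C v \<in> pts G"
    "ple G (vpt G (eta T G C v)) (vertex_map T G C v)"
    "(height T v + height T (phi T C v)) / 2 \<le> snd (vertex_map T G C v)"
proof -
  have "Lam T C v = {}" using none Lam_D[of _ T C v] unfolding vle_iff by blast
  moreover have "v \<notin> fst ` C" using none by (force simp: vle_def)
  ultimately have M: "vertex_map T G C v = point_above G (vpt G (eta T G C v))
      (max (height G (eta T G C v)) ((height T v + height T (phi T C v)) / 2))"
    by (simp add: vertex_map_def)
  have "eta T G C v \<in> verts G" using eta_pair[OF assms] pair_verts(2) by blast
  then have "vpt G (eta T G C v) \<in> pts G" by (rule vpt_in_pts[OF G])
  note * = point_above[OF G this, of "max (height G (eta T G C v))
      ((height T v + height T (phi T C v)) / 2)", folded M]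
  show "vertex_map T G C v \<in> pts G"
    "ple G (vpt G (eta T G C v)) (vertex_map T G C v)"
    "(height T v + height T (phi T C v)) / 2 \<le> snd (vertex_map T G C v)"
    using * by (simp_all add: vpt_def)
  show "v \<in> verts T - unused T C"
    using v \<open>Lam T C v = {}\<close> by (simp add: unused_def)
qed

lemma chi_least:
  assumes ne: "Lam T C v \<noteq> {}"
  shows "is_least (vle G)
    {u \<in> verts G. \<forall>s \<in> {w. \<exists>c. (c, w) \<in> C \<and> c \<in> Lam T C v}. vle G s u} (chi T G C v)"
  unfolding chi_def
proof (rule is_least_LCA[OF G])
  show "{w. \<exists>c. (c, w) \<in> C \<and> c \<in> Lam T C v} \<subseteq> verts G" using pair_verts(2) by blast
  obtain c where "c \<in> Lam T C v" using ne by blast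
  moreover from Lam_D(1)[OF this] obtain w where "(c, w) \<in> C" by auto
  ultimately show "{w. \<exists>c. (c, w) \<in> C \<and> c \<in> Lam T C v} \<noteq> {}" by blast
qed

text \<open>
  The three cases in the definition of the vertex map, in the form in which they are used below:
  in the last one, the definition says that no maximal coupled vertex lies strictly below, and
  this becomes the absence of any coupled vertex below.
\<close>

lemma vertex_cases:
  assumes "v \<in> verts T - unused T C"
  obtains (coupled) d where "(v, d) \<in> C" "vertex_map T G C v = vpt G d"
  | (branching) "v \<notin> fst ` C" "Lam T C v \<noteq> {}" "vertex_map T G C v = vpt G (chi T G C v)"
  | (deleted_branch) "\<forall>c \<in> fst ` C. \<not> vle T c v"
proof -
  consider "v \<in> fst ` C" | "v \<notin> fst ` C" "Lam T C v \<noteq> {}" | "v \<notin> fst ` C" "Lam T C v = {}"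
    by blast
  then show ?thesis
  proof cases
    case 1
    then show ?thesis using coupled vertex_map_coupled by fastforce
  next
    case 2
    then show ?thesis using branching finite_Lam[OF T, of C v] by (simp add: vertex_map_def)
  next
    case 3
    then have "\<not> vle T c v" if "c \<in> fst ` C" for c
      using that ex_Lam_above[OF T that, of v] by (auto simp: vle_iff)
    then show ?thesis using deleted_branch by blast
  qed
qed

lemma vertex_map_pts:
  assumes v: "v \<in> verts T - unused T C"
  shows "vertex_map T G C v \<in> pts G"
  using v
proof (cases rule: vertex_cases)
  case (coupled d)
  then show ?thesis using vpt_in_pts[OF G] pair_verts by simp
next
  case branching
  then show ?thesis
    using vpt_in_pts[OF G] chi_least[of v] by (simp add: is_least_def)
next
  case deleted_branch
  then show ?thesis using vertex_map_deleted_branch(2) v by blast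
qed

lemma vertex_map_close:
  assumes "v \<in> verts T - unused T C"
  shows "\<bar>snd (vertex_map T G C v) - height T v\<bar> \<le> \<epsilon>"
proof -
  have "\<bar>snd (vertex_map T G C v) - height T v\<bar> \<le> vertex_cost T G C"
    unfolding vertex_cost_def using assms finite_verts[OF T] by (intro Max_ge) auto
  then show ?thesis using bound by (simp add: coupling_norm_def)
qed

text \<open>
  At an unused vertex, the maximal coupled vertex below it is also the maximal vertex below it that
  is mapped directly, up to vertices in deleted branches: any other vertex in between would have
  the same single maximal coupled vertex below it and hence be unused itself.
\<close>

lemma anchor_unused:
  assumes v: "v \<in> unused T C"
  shows "anchor T C v \<in> fst ` C" "vlt T (anchor T C v) v"
    "\<And>c. c \<in> fst ` C \<Longrightarrow> vle T c v \<Longrightarrow> vle T c (anchor T C v)"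
    "\<And>u. vlt T (anchor T C v) u \<Longrightarrow> vle T u v \<Longrightarrow> u \<in> unused T C"
proof -
  let ?a = "anchor T C v"
  have L: "Lam T C v = {?a}" using unused_anchor[OF v] .
  show a: "?a \<in> fst ` C" "vlt T ?a v" using Lam_D[of ?a T C v] L by auto
  show above: "vle T c ?a" if "c \<in> fst ` C" "vle T c v" for c
  proof -
    have "c \<noteq> v" using that v coupled_not_unused by fastforce
    then show ?thesis using ex_Lam_above[OF T that(1), of v] that L by (auto simp: vle_iff)
  qed
  show "u \<in> unused T C" if u: "vlt T ?a u" "vle T u v" for u
  proof -
    have not_above: "\<not> vlt T ?a b" if "b \<in> fst ` C" "vle T b v" for b
      using above[OF that] vlt_vle_trans[of T ?a b ?a] vlt_irrefl[OF T] by blast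
    have below: "vle T b v" if "vlt T b u" for b
      using vle_trans[of T b u v] that u by (auto simp: vle_iff)
    have "Lam T C u = {?a}"
    proof (intro equalityI subsetI)
      fix s assume s: "s \<in> Lam T C u"
      then have "vle T s ?a" using above[OF Lam_D(1)[OF s] below[OF Lam_D(2)[OF s]]] by simp
      moreover have "\<not> vlt T s ?a" using s a(1) u(1) by (auto simp: Lam_def max_elems_def)
      ultimately show "s \<in> {?a}" by (auto simp: vle_iff)
    next
      fix s assume "s \<in> {?a}"
      then show "s \<in> Lam T C u"
        using a(1) u(1) not_above below by (auto simp: Lam_def max_elems_def)
    qed
    then show ?thesis using vlt_height(2)[OF T u(1)] by (simp add: unused_def)
  qed
qed

lemma anchor_props:
  assumes v: "v \<in> verts T"
  shows "anchor T C v \<in> verts T - unused T C" "vle T (anchor T C v) v"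
proof -
  have "anchor T C v \<in> verts T - unused T C \<and> vle T (anchor T C v) v"
  proof (cases "v \<in> unused T C")
    case True
    then show ?thesis
      using anchor_unused(1,2)[OF True] pair_verts(1) coupled_not_unused by (force simp: vle_iff)
  qed (use v in \<open>auto simp: anchor_def vle_def\<close>)
  then show "anchor T C v \<in> verts T - unused T C" "vle T (anchor T C v) v" by auto
qed

lemma base_point_pts: "v \<in> verts T \<Longrightarrow> base_point T G C v \<in> pts G"
  unfolding base_point_def using vertex_map_pts anchor_props(1) by blast

lemma base_point_height:
  assumes "v \<in> verts T"
  shows "snd (base_point T G C v) \<le> height T v + \<epsilon>"
  using vertex_map_close[OF anchor_props(1)[OF assms]] vle_height[OF T anchor_props(2)[OF assms]]
  by (simp add: base_point_def)

lemma low_vert_eq: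
  assumes p: "p \<in> pts T"
  shows "low_vert T C p = anchor T C (fst p)"
proof -
  let ?v = "fst p" and ?a = "anchor T C (fst p)"
  define M where "M = max_elems (vlt T) {u \<in> verts T - unused T C. vle T u ?v}"
  have v: "?v \<in> verts T" using pts_fst[OF p] .
  have "{u \<in> verts T. ple T (vpt T u) p \<and> u \<in> fst ` C \<union> deleted T C} =
      {u \<in> verts T - unused T C. vle T u ?v}"
    using verts_not_unused ple_vpt_iff[OF T p] by auto
  then have low: "low_vert T C p =
      (if \<exists>!u. u \<in> M then (THE u. u \<in> M) else (THE u. u \<in> M \<and> u \<in> fst ` C))"
    by (simp add: low_vert_def M_def)
  have aM: "?a \<in> M"
  proof -
    have "\<not> vlt T ?a u" if "u \<in> verts T - unused T C" "vle T u ?v" for u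
    proof (cases "?v \<in> unused T C")
      case True
      then show ?thesis using anchor_unused(4)[OF True, of u] that by blast
    next
      case False
      then show ?thesis
        using that vlt_vle_trans[of T ?v u ?v] vlt_irrefl[OF T] by (auto simp: anchor_def)
    qed
    then show ?thesis using anchor_props[OF v] by (auto simp: M_def max_elems_def)
  qed
  show ?thesis
  proof (cases "\<exists>!u. u \<in> M")
    case True
    then show ?thesis using low aM by (auto intro: the_equality)
  next
    case False
    have "?v \<in> unused T C"
    proof (rule ccontr)
      assume *: "?v \<notin> unused T C"
      then have "u = ?v" if "u \<in> M" for u
        using that v by (auto simp: M_def max_elems_def vle_iff)
      then show False using False aM by blast
    qed
    note a = anchor_unused[OF this]
    have "(THE u. u \<in> M \<and> u \<in> fst ` C) = ?a"
    proof (rule the_equality)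
      show "?a \<in> M \<and> ?a \<in> fst ` C" using aM a(1) by simp
      fix u assume "u \<in> M \<and> u \<in> fst ` C"
      then show "u = ?a" using a(3)[of u] aM by (auto simp: M_def max_elems_def vle_iff)
    qed
    then show ?thesis using low False by simp
  qed
qed

lemma coupling_map_eq:
  assumes p: "p \<in> pts T"
  shows "coupling_map T G C \<epsilon> p = point_above G (base_point T G C (fst p)) (snd p + \<epsilon>)"
proof -
  have shifted: "shifted_vertex_map T G C \<epsilon> x = point_above G (vertex_map T G C x) (height T x + \<epsilon>)"
    for x
    by (simp add: shifted_vertex_map_def shift_def)
  show ?thesis
  proof (cases "p \<in> vpt T ` (verts T - unused T C)")
    case True
    then have "anchor T C (fst p) = fst p" "snd p = height T (fst p)"
      by (auto simp: vpt_def anchor_def)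
    then show ?thesis using True by (simp add: coupling_map_def shifted base_point_def)
  next
    case False
    let ?a = "anchor T C (fst p)"
    have v: "fst p \<in> verts T" using pts_fst[OF p] .
    have B: "base_point T G C (fst p) \<in> pts G" using base_point_pts[OF v] .
    have "snd (base_point T G C (fst p)) \<le> height T ?a + \<epsilon>"
      using vertex_map_close[OF anchor_props(1)[OF v]] by (simp add: base_point_def)
    note q = point_above[OF G B this]
    have "height T ?a + \<epsilon> \<le> snd p + \<epsilon>"
      using vle_height[OF T anchor_props(2)[OF v]] pts_height[OF p] by simp
    then have "snd (point_above G (base_point T G C (fst p)) (height T ?a + \<epsilon>)) \<le> snd p + \<epsilon>"
      using q by simp
    (* Going up in two steps ends at the same point as going up in one. *)
    note r = point_above[OF G q(1) this]
    have "coupling_map T G C \<epsilon> p =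
        point_above G (point_above G (base_point T G C (fst p)) (height T ?a + \<epsilon>)) (snd p + \<epsilon>)"
      using False by (simp add: coupling_map_def low_vert_eq[OF p] shifted base_point_def)
    also have "\<dots> = point_above G (base_point T G C (fst p)) (snd p + \<epsilon>)"
      using point_above_eqI[OF G B r(1) ple_trans[OF q(2) r(2)] r(3)] by simp
    finally show ?thesis .
  qed
qed

lemma coupling_map_props:
  assumes p: "p \<in> pts T"
  shows "coupling_map T G C \<epsilon> p \<in> pts G"
    "ple G (base_point T G C (fst p)) (coupling_map T G C \<epsilon> p)"
    "snd (coupling_map T G C \<epsilon> p) = snd p + \<epsilon>"
proof -
  have "snd (base_point T G C (fst p)) \<le> snd p + \<epsilon>"
    using base_point_height[OF pts_fst[OF p]] pts_height[OF p] by simp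
  from point_above[OF G base_point_pts[OF pts_fst[OF p]] this]
  show "coupling_map T G C \<epsilon> p \<in> pts G"
    "ple G (base_point T G C (fst p)) (coupling_map T G C \<epsilon> p)"
    "snd (coupling_map T G C \<epsilon> p) = snd p + \<epsilon>"
    by (simp_all add: coupling_map_eq[OF p])
qed

text \<open>
  All later comparisons in the second tree go back to this one. It treats coupled, branching and
  unused vertices alike, so that the proof of monotonicity need not distinguish the kind of the
  upper vertex.
\<close>

lemma pair_below_base_point:
  assumes v: "v \<in> verts T" and cd: "(c, d) \<in> C" and cv: "vle T c v"
  shows "ple G (vpt G d) (base_point T G C v)"
proof -
  let ?a = "anchor T C v"
  have ca: "vle T c ?a"
  proof (cases "v \<in> unused T C")
    case True
    then show ?thesis using anchor_unused(3)[OF True] cd cv by force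
  qed (use cv in \<open>simp add: anchor_def\<close>)
  have "vle G d (fst (vertex_map T G C ?a))"
    using anchor_props(1)[OF v]
  proof (cases rule: vertex_cases)
    case (coupled e)
    then show ?thesis using pair_vle_iff[OF cd] ca by (simp add: vpt_def)
  next
    case branching
    have "vlt T c ?a" using ca branching(1) cd by (force simp: vle_iff)
    then obtain b e where b: "b \<in> Lam T C ?a" "vle T c b" "(b, e) \<in> C"
    proof -
      have "c \<in> fst ` C" using cd by force
      from ex_Lam_above[OF T this \<open>vlt T c ?a\<close>] obtain b where "b \<in> Lam T C ?a" "vle T c b" ..
      moreover from Lam_D(1)[OF this(1)] obtain e where "(b, e) \<in> C" by auto
      ultimately show ?thesis using that by blast
    qed
    have "vle G d e" using pair_vle_iff[OF cd b(3)] b by simp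
    moreover have "vle G e (chi T G C ?a)"
      using chi_least[OF branching(2)] anchor_props(1)[OF v] b by (auto simp: is_least_def)
    ultimately show ?thesis using branching(3) vle_trans[of G d e] by (simp add: vpt_def)
  next
    case deleted_branch
    then show ?thesis using ca cd by force
  qed
  then show ?thesis
    using ple_vpt_iff[OF G base_point_pts[OF v]] by (simp add: base_point_def)
qed

lemma pair_below_coupling_map:
  assumes p: "p \<in> pts T" and cd: "(c, d) \<in> C" and "vle T c (fst p)"
  shows "ple G (vpt G d) (coupling_map T G C \<epsilon> p)"
  using ple_trans[OF pair_below_base_point[OF pts_fst[OF p] cd assms(3)] coupling_map_props(2)[OF p]] .

text \<open>
  A vertex in a deleted branch is sent above the image of some coupled vertex below
  \<^term>\<open>phi T C v\<close>. Another vertex above it either is above \<^term>\<open>phi T C v\<close>, too, or belongs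
  to the same branch and has the same \<open>\<phi>\<close> and \<open>\<eta>\<close>.
\<close>

lemma eta_below_coupling_map:
  assumes v: "v \<in> verts T" and none: "\<forall>c \<in> fst ` C. \<not> vle T c v"
    and p: "p \<in> pts T" and vp: "vle T v (fst p)"
  shows "ple G (vpt G (eta T G C v)) (coupling_map T G C \<epsilon> p)"
proof (cases "\<exists>c d. (c, d) \<in> C \<and> vle T c (fst p)")
  case True
  then have "v \<noteq> fst p" using none by force
  then have "vlt T v (fst p)" using vp by (simp add: vle_iff)
  then have phi: "vle T (phi T C v) (fst p)"
    using phi_least[OF v none] True pts_fst[OF p] unfolding is_least_def by force
  obtain c where c: "(c, eta T G C v) \<in> C" "vle T c (phi T C v)"
    using eta_pair[OF v none] by blast
  show ?thesis using pair_below_coupling_map[OF p c(1) vle_trans[OF c(2) phi]] .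
next
  case False
  let ?w = "fst p"
  have w: "?w \<in> verts T" using pts_fst[OF p] .
  have none': "\<forall>c \<in> fst ` C. \<not> vle T c ?w" using False by auto
  have "vlt T v u \<longleftrightarrow> vlt T ?w u" if u: "vle T c u" "c \<in> fst ` C" for u c
  proof
    assume "vlt T v u"
    moreover have "\<not> vle T u ?w" using none' u vle_trans[of T c u ?w] by blast
    ultimately show "vlt T ?w u" using vle_chain[OF T _ vp, of u] by (auto simp: vle_iff)
  qed (rule vle_vlt_trans[OF vp])
  then have "{u \<in> verts T. vlt T v u \<and> (\<exists>c. vle T c u \<and> c \<in> fst ` C)} =
      {u \<in> verts T. vlt T ?w u \<and> (\<exists>c. vle T c u \<and> c \<in> fst ` C)}"
    by blast
  then have "phi T C v = phi T C ?w" by (simp add: phi_def)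
  then have "eta T G C v = eta T G C ?w" by (simp add: eta_def)
  moreover have "anchor T C ?w = ?w"
    using vertex_map_deleted_branch(1)[OF w none'] by (simp add: anchor_def)
  ultimately have "ple G (vpt G (eta T G C v)) (base_point T G C ?w)"
    using vertex_map_deleted_branch(3)[OF w none'] by (simp add: base_point_def)
  then show ?thesis using coupling_map_props(2)[OF p] ple_trans by blast
qed

text \<open>
  For a coupled anchor this is the comparison of pairs, and for a branching one the least common
  ancestor is below every common upper bound. For an anchor in a deleted branch both sides lie
  above \<^term>\<open>eta T G C v\<close>, and the cost bound puts the left one below height
  \<^term>\<open>height T v + \<epsilon>\<close>.
\<close>

lemma base_point_below_coupling_map:
  assumes v: "v \<in> verts T" and p: "p \<in> pts T" and vp: "vle T v (fst p)"
  shows "ple G (base_point T G C v) (coupling_map T G C \<epsilon> p)"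
proof -
  let ?a = "anchor T C v" and ?q = "coupling_map T G C \<epsilon> p"
  have av: "vle T ?a (fst p)" using vle_trans[OF anchor_props(2)[OF v] vp] .
  have a: "?a \<in> verts T" using anchor_props(1)[OF v] by simp
  have q: "?q \<in> pts G" using coupling_map_props(1)[OF p] .
  show ?thesis
    using anchor_props(1)[OF v]
  proof (cases rule: vertex_cases)
    case (coupled d)
    then show ?thesis
      using pair_below_coupling_map[OF p coupled(1) av] by (simp add: base_point_def)
  next
    case branching
    have "vle G d (fst ?q)" if "(b, d) \<in> C" "b \<in> Lam T C ?a" for b d
    proof -
      have "vle T b (fst p)" using vlt_vle_trans[OF Lam_D(2)[OF that(2)] av] by (simp add: vle_iff)
      then show ?thesis using pair_below_coupling_map[OF p that(1)] ple_vpt_iff[OF G q] by blast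
    qed
    then have "vle G (chi T G C ?a) (fst ?q)"
      using chi_least[OF branching(2)] pts_fst[OF q] by (auto simp: is_least_def)
    then show ?thesis using branching(3) ple_vpt_iff[OF G q] by (simp add: base_point_def)
  next
    case deleted_branch
    have "snd (base_point T G C v) \<le> snd ?q"
      using base_point_height[OF v] vle_height[OF T vp] pts_height[OF p] coupling_map_props(3)[OF p]
      by simp
    moreover have "ple G (vpt G (eta T G C ?a)) (base_point T G C v)"
      using vertex_map_deleted_branch(3)[OF a deleted_branch] by (simp add: base_point_def)
    ultimately show ?thesis
      using ple_height_cmp[OF G base_point_pts[OF v] q _
          eta_below_coupling_map[OF a deleted_branch p av]] by blast
  qed
qed

lemma coupling_map_mono:
  assumes p: "p \<in> pts T" and q: "q \<in> pts T" and pq: "ple T p q"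
  shows "ple G (coupling_map T G C \<epsilon> p) (coupling_map T G C \<epsilon> q)"
proof (rule ple_height_cmp[OF G])
  show "ple G (base_point T G C (fst p)) (coupling_map T G C \<epsilon> q)"
    using base_point_below_coupling_map[OF pts_fst[OF p] q] pq by (simp add: ple_def)
qed (use coupling_map_props[OF p] coupling_map_props[OF q] pq in \<open>auto simp: ple_def\<close>)

section \<open>The map and its opposite are inverse up to a shift\<close>

lemma vertex_below_round_trip:
  assumes v: "v \<in> verts T"
  shows "ple T (vpt T v) (coupling_map G T (C\<inverse>) \<epsilon> (coupling_map T G C \<epsilon> (vpt T v)))"
proof -
  interpret opp: bounded_coupling G T "C\<inverse>" \<epsilon> by (rule dual)
  let ?y = "coupling_map T G C \<epsilon> (vpt T v)"
  let ?q = "coupling_map G T (C\<inverse>) \<epsilon> ?y"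
  have vp: "vpt T v \<in> pts T" using vpt_in_pts[OF T v] .
  note y = coupling_map_props[OF vp] and q = opp.coupling_map_props[OF coupling_map_props(1)[OF vp]]
  have hq: "snd ?q = height T v + 2 * \<epsilon>" using y(3) q(3) by (simp add: vpt_def)
  have ret: "ple T (vpt T c) ?q" if "(c, d) \<in> C" "ple G (vpt G d) ?y" for c d
    using opp.pair_below_coupling_map[OF y(1), of d c] that ple_vpt_iff[OF G y(1)] by simp
  have eps: "0 \<le> \<epsilon>" using vertex_map_close[OF anchor_props(1)[OF v]] by linarith
  show ?thesis
  proof (cases "\<exists>c d. (c, d) \<in> C \<and> vle T c v")
    case True
    then obtain c d where cd: "(c, d) \<in> C" "vle T c v" by blast
    have "ple T (vpt T c) ?q"
      using ret[OF cd(1)] pair_below_coupling_map[OF vp cd(1)] cd(2) by (simp add: vpt_def)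
    moreover have "ple T (vpt T c) (vpt T v)"
      using ple_vpt_iff[OF T vp] cd(2) by (simp add: vpt_def)
    ultimately show ?thesis
      using ple_height_cmp[OF T vp q(1)] hq eps by (simp add: vpt_def)
  next
    case False
    let ?u = "phi T C v"
    have none: "\<forall>c \<in> fst ` C. \<not> vle T c v" using False by auto
    have u: "?u \<in> verts T" "vlt T v ?u"
      using phi_least[OF v none] by (auto simp: is_least_def)
    have up: "vpt T ?u \<in> pts T" using vpt_in_pts[OF T u(1)] .
    obtain c where c: "(c, eta T G C v) \<in> C" "vle T c ?u" using eta_pair[OF v none] by blast
    have "ple G (vpt G (eta T G C v)) ?y"
      using eta_below_coupling_map[OF v none vp] by (simp add: vpt_def vle_def)
    then have "ple T (vpt T c) ?q" using ret[OF c(1)] by simp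
    moreover have "ple T (vpt T c) (vpt T ?u)"
      using ple_vpt_iff[OF T up] c(2) by (simp add: vpt_def)
    (* The cost at v is at least half the height difference of v and \<phi>(v). *)
    moreover have "height T ?u \<le> snd ?q"
      using vertex_map_deleted_branch(4)[OF v none] hq
        vertex_map_close[OF vertex_map_deleted_branch(1)[OF v none]] by argo
    ultimately have "ple T (vpt T ?u) ?q"
      using ple_height_cmp[OF T up q(1)] by (simp add: vpt_def)
    moreover have "ple T (vpt T v) (vpt T ?u)"
      using ple_vpt_iff[OF T up] u(2) by (simp add: vpt_def vle_iff)
    ultimately show ?thesis using ple_trans by blast
  qed
qed

lemma coupling_map_round_trip:
  assumes p: "p \<in> pts T"
  shows "coupling_map G T (C\<inverse>) \<epsilon> (coupling_map T G C \<epsilon> p) = shift T (2 * \<epsilon>) p"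
    "ple T p (shift T (2 * \<epsilon>) p)"
proof -
  interpret opp: bounded_coupling G T "C\<inverse>" \<epsilon> by (rule dual)
  let ?\<alpha> = "coupling_map T G C \<epsilon>" and ?\<beta> = "coupling_map G T (C\<inverse>) \<epsilon>"
  have v: "fst p \<in> verts T" using pts_fst[OF p] .
  have vp: "vpt T (fst p) \<in> pts T" "ple T (vpt T (fst p)) p"
    using vpt_in_pts[OF T v] ple_vpt_iff[OF T p] by (auto simp: vle_def)
  note q = opp.coupling_map_props[OF coupling_map_props(1)[OF p]]
  have eps: "0 \<le> \<epsilon>" using vertex_map_close[OF anchor_props(1)[OF v]] by linarith
  have "ple T (vpt T (fst p)) (?\<beta> (?\<alpha> p))"
    using vertex_below_round_trip[OF v] coupling_map_mono[OF vp(1) p vp(2)]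
      opp.coupling_map_mono[OF coupling_map_props(1)[OF vp(1)] coupling_map_props(1)[OF p]]
      ple_trans by blast
  then have above: "ple T p (?\<beta> (?\<alpha> p))"
    using ple_height_cmp[OF T p q(1) vp(2)] q(3) coupling_map_props(3)[OF p] eps by simp
  then show eq: "?\<beta> (?\<alpha> p) = shift T (2 * \<epsilon>) p"
    unfolding shift_def
    using q(3) coupling_map_props(3)[OF p] by (intro point_above_eqI[OF T p q(1), symmetric]) auto
  show "ple T p (shift T (2 * \<epsilon>) p)" using above eq by simp
qed

end

theorem theorem1:
  fixes T :: "'a mtree" and G :: "'b mtree" and C :: "('a \<times> 'b) set" and \<epsilon> :: real
  assumes "merge_tree T" and "merge_tree G"
    and "coupling T G C"
    and "\<epsilon> \<ge> coupling_norm T G C"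
  shows "good_map \<epsilon> T G (coupling_map T G C \<epsilon>)"
proof -
  interpret bounded_coupling T G C \<epsilon> by unfold_locales (fact assms)+
  interpret opp: bounded_coupling G T "C\<inverse>" \<epsilon> by (rule dual)
  let ?\<alpha> = "coupling_map T G C \<epsilon>" and ?\<beta> = "coupling_map G T (C\<inverse>) \<epsilon>"
  have maps: "?\<alpha> \<in> pts T \<rightarrow> pts G" using coupling_map_props(1) by blast
  have comparison: "plt T (shift T (2 * \<epsilon>) p) (shift T (2 * \<epsilon>) q)"
    if p: "p \<in> pts T" and q: "q \<in> pts T" and less: "plt G (?\<alpha> p) (?\<alpha> q)" for p q
  proof -
    note mem = coupling_map_props(1)[OF p] coupling_map_props(1)[OF q]
    have "snd (?\<alpha> p) \<noteq> snd (?\<alpha> q)"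
      using less ple_height_eq[OF G mem] by (auto simp: plt_def)
    then have "?\<beta> (?\<alpha> p) \<noteq> ?\<beta> (?\<alpha> q)"
      using opp.coupling_map_props(3) mem by (metis add_right_cancel)
    then show ?thesis
      using opp.coupling_map_mono[OF mem] less coupling_map_round_trip(1) p q
      by (auto simp: plt_def)
  qed
  have cofinal: "\<exists>w. is_least (ple G) {y' \<in> ?\<alpha> ` pts T. plt G y y'} w \<and> snd w - snd y \<le> 2 * \<epsilon>"
    if y: "y \<in> pts G - ?\<alpha> ` pts T" for y
  proof -
    let ?z = "?\<alpha> (?\<beta> y)"
    have yp: "y \<in> pts G" using y by simp
    have z: "?z \<in> ?\<alpha> ` pts T" using opp.coupling_map_props(1)[OF yp] by blast
    have yz: "ple G y ?z" using opp.coupling_map_round_trip[OF yp] by simp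
    have hz: "snd ?z = snd y + 2 * \<epsilon>"
      using coupling_map_props(3)[OF opp.coupling_map_props(1)[OF yp]] opp.coupling_map_props(3)[OF yp]
      by simp
    have A: "finite ((\<lambda>v. ?\<alpha> (vpt T v)) ` verts T)" "(\<lambda>v. ?\<alpha> (vpt T v)) ` verts T \<subseteq> pts G"
      using finite_verts[OF T] coupling_map_props(1)[OF vpt_in_pts[OF T]] by blast+
    obtain w where w: "is_least (ple G) {y' \<in> ?\<alpha> ` pts T. plt G y y'} w"
      using ex_least_point_above[OF G A yp image_mono_map[OF T G maps coupling_map_props(3)
          coupling_map_mono] _ z yz] y by blast
    have "plt G y ?z" using yz z y by (auto simp: plt_def)
    then have "ple G w ?z" using w z unfolding is_least_def by blast
    then have "snd w \<le> snd ?z" by (simp add: ple_def)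
    then have "snd w - snd y \<le> 2 * \<epsilon>" using hz by simp
    then show ?thesis using w by blast
  qed
  show ?thesis
    unfolding good_map_def
  proof (intro conjI ballI impI)
    show "continuous_map (tree_top T) (tree_top G) ?\<alpha>"
      using continuous_mono_map[OF T G maps coupling_map_props(3) coupling_map_mono] .
  qed (fact maps coupling_map_props(3) comparison cofinal)+
qed

end
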